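(* Let $r\ge 0$ be a real number and let $l=\{a_i;\ i=1,2,3,\dots\}$ be a sequence of real numbers. Then $l$ is statistically $r$-convergent if and only if every statistically dense subsequence of $l$ is statistically $r$-convergent.
   Context: $\mathbb{N}=\{1,2,3,\dots\}$. For $K\subseteq\mathbb{N}$ put $K_n=\{k\in K: k\le n\}$; the asymptotic density of $K$ is $d(K)=\lim_{n\to\infty}\frac1n|K_n|$ whenever the limit exists. For a real $r\ge0$, a sequence $l=\{a_i\}$ of real numbers statistically $r$-converges to $a\in\mathbb{R}$ if for every $\varepsilon>0$ the set $\{i\in\mathbb{N}: |a_i-a|\ge r+\varepsilon\}$ has density $0$; it is statistically $r$-convergent if it statistically $r$-converges to some real number. A subset $K\subseteq\mathbb{N}$ is statistically dense if $d(K)=1$. A subsequence $h$ of $l$ is statistically dense in $l$ if the set of all indices (in $l$) of elements of $h$ is statistically dense; the subsequence $h=\{b_k;\ k=1,2,3,\dots\}$ is itself a sequence indexed by $k=1,2,3,\dots$, and its statistical $r$-convergence refers to this indexing. *)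

theory Defs
  imports Complex_Main
begin

text \<open>
  The natural numbers start at 1: index sets are subsets of \<^term>\<open>{1::nat..}\<close>, and a sequence
  is a function on \<^typ>\<open>nat\<close> whose value at 0 is never consulted.
\<close>

text \<open>
  Stated as a relation, so that the existence of the limit is part of the claim.
  The term with \<open>n = 0\<close> is 0 and does not affect the limit.
\<close>

definition has_density :: "nat set \<Rightarrow> real \<Rightarrow> bool" where
  "has_density K d \<longleftrightarrow>
     K \<subseteq> {1..} \<and> (\<lambda>n. real (card {k \<in> K. k \<le> n}) / real n) \<longlonglongrightarrow> d"

definition statistically_dense :: "nat set \<Rightarrow> bool" where
  "statistically_dense K \<longleftrightarrow> has_density K 1"

definition stat_r_converges :: "real \<Rightarrow> (nat \<Rightarrow> real) \<Rightarrow> real \<Rightarrow> bool" where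
  "stat_r_converges r l a \<longleftrightarrow>
     (\<forall>\<epsilon>>0. has_density {i \<in> {1..}. \<bar>l i - a\<bar> \<ge> r + \<epsilon>} 0)"

definition stat_r_convergent :: "real \<Rightarrow> (nat \<Rightarrow> real) \<Rightarrow> bool" where
  "stat_r_convergent r l \<longleftrightarrow> (\<exists>a. stat_r_converges r l a)"

text \<open>
  A subsequence is given by its increasing enumeration \<open>s\<close> of indices, and \<open>s ` {1..}\<close> is the
  set of indices in \<open>l\<close> of the elements of \<open>h\<close>. The same \<open>h\<close> may arise from several \<open>s\<close>; it
  counts as dense as soon as one of these selections has a dense index set.
\<close>

definition subsequence_via :: "(nat \<Rightarrow> nat) \<Rightarrow> (nat \<Rightarrow> real) \<Rightarrow> (nat \<Rightarrow> real) \<Rightarrow> bool" where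
  "subsequence_via s h l \<longleftrightarrow>
     strict_mono_on {1..} s \<and> s ` {1..} \<subseteq> {1..} \<and> (\<forall>k\<ge>1. h k = l (s k))"

definition stat_dense_subsequence :: "(nat \<Rightarrow> real) \<Rightarrow> (nat \<Rightarrow> real) \<Rightarrow> bool" where
  "stat_dense_subsequence h l \<longleftrightarrow>
     (\<exists>s. subsequence_via s h l \<and> statistically_dense (s ` {1..}))"

end

theory Submission
  imports Defs
begin

text \<open>
  A sequence is a statistically dense subsequence of itself, so only the passage from \<open>l\<close> to a
  statistically dense subsequence \<open>h = l \<circ> s\<close> with the same limit needs an argument. The bad
  indices of \<open>h\<close> are the preimage under \<open>s\<close> of the bad indices \<open>B\<close> of \<open>l\<close>, and \<open>s\<close> injects those
  up to \<open>n\<close> into the elements of \<open>B\<close> up to \<open>s n\<close>. Therefore their proportion up to \<open>n\<close> is at most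
  \<open>card {k \<in> B. k \<le> s n} / s n\<close>, which tends to \<open>0\<close>, times \<open>s n / n\<close>. Exactly \<open>n\<close> of the selected
  indices are \<open>\<le> s n\<close>, so \<open>n / s n\<close> is the counting ratio of the selected set at \<open>s n\<close>. It tends
  to \<open>1\<close>, and so the factor \<open>s n / n\<close> is harmless
  (\<open>density_ratio_enumeration\<close>, \<open>has_density_0_preimage\<close>).
\<close>

lemma strict_mono_on_from_1_ge:
  fixes s :: "nat \<Rightarrow> nat"
  assumes mono: "strict_mono_on {1..} s" and range: "s ` {1..} \<subseteq> {1..}" and "n \<ge> 1"
  shows "n \<le> s n"
  using \<open>n \<ge> 1\<close>
proof (induction n rule: nat_induct_at_least)
  case base
  then show ?case using range by auto
next
  case (Suc n)
  have "s n < s (Suc n)"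
    using Suc.hyps by (intro strict_mono_onD[OF mono]) auto
  then show ?case using Suc.IH by simp
qed

lemma filterlim_strict_mono_on_from_1:
  fixes s :: "nat \<Rightarrow> nat"
  assumes "strict_mono_on {1..} s" "s ` {1..} \<subseteq> {1..}"
  shows "filterlim s at_top sequentially"
proof (rule filterlim_at_top_mono[OF filterlim_ident])
  show "\<forall>\<^sub>F n in sequentially. n \<le> s n"
    using eventually_ge_at_top[of 1] by (rule eventually_mono) (rule strict_mono_on_from_1_ge[OF assms])
qed

lemma card_enumerated_upto:
  fixes s :: "nat \<Rightarrow> nat"
  assumes mono: "strict_mono_on {1..} s" and "n \<ge> 1"
  shows "card {k \<in> s ` {1..}. k \<le> s n} = n"
proof -
  have "{k \<in> s ` {1..}. k \<le> s n} = s ` {1..n}"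
    using strict_mono_on_less_eq[OF mono] \<open>n \<ge> 1\<close> by auto
  moreover have "inj_on s {1..n}"
    by (rule inj_on_subset[OF strict_mono_on_imp_inj_on[OF mono]]) auto
  ultimately show ?thesis
    by (simp add: card_image)
qed

text \<open>
  Sampling the counting ratio of the index set along its own enumeration \<open>s\<close> turns it into
  \<open>n / s n\<close>, because the count at \<open>s n\<close> is \<open>n\<close>.
\<close>

lemma density_ratio_enumeration:
  fixes s :: "nat \<Rightarrow> nat"
  assumes mono: "strict_mono_on {1..} s" and dens: "has_density (s ` {1..}) d"
  shows "(\<lambda>n. real n / real (s n)) \<longlonglongrightarrow> d"
proof -
  have range: "s ` {1..} \<subseteq> {1..}"
    using dens by (simp add: has_density_def)
  have "(\<lambda>n. real (card {k \<in> s ` {1..}. k \<le> s n}) / real (s n)) \<longlonglongrightarrow> d"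
    using filterlim_compose[OF _ filterlim_strict_mono_on_from_1[OF mono range]] dens
    unfolding has_density_def by blast
  moreover have "\<forall>\<^sub>F n in sequentially.
      real (card {k \<in> s ` {1..}. k \<le> s n}) / real (s n) = real n / real (s n)"
    using eventually_ge_at_top[of 1]
    by (rule eventually_mono) (simp only: card_enumerated_upto[OF mono])
  ultimately show ?thesis
    by (rule Lim_transform_eventually)
qed

text \<open>
  Renumbering along \<open>s\<close> can only enlarge proportions by the factor \<open>s n / n\<close>, and this factor
  stays bounded as soon as the range of \<open>s\<close> has positive density.
\<close>

lemma has_density_0_preimage:
  fixes s :: "nat \<Rightarrow> nat"
  assumes mono: "strict_mono_on {1..} s" and dens: "has_density (s ` {1..}) d" and "d \<noteq> 0"
    and B: "has_density B 0"
  shows "has_density {k \<in> {1..}. s k \<in> B} 0"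
proof -
  let ?ratio = "\<lambda>A n. real (card {k \<in> A. k \<le> n}) / real n"
  let ?P = "{k \<in> {1..}. s k \<in> B}"
  have range: "s ` {1..} \<subseteq> {1..}"
    using dens by (simp add: has_density_def)
  have "(\<lambda>n. inverse (real n / real (s n))) \<longlonglongrightarrow> inverse d"
    using density_ratio_enumeration[OF mono dens] \<open>d \<noteq> 0\<close> by (rule tendsto_inverse)
  moreover have "(\<lambda>n. ?ratio B (s n)) \<longlonglongrightarrow> 0"
    using filterlim_compose[OF _ filterlim_strict_mono_on_from_1[OF mono range]] B
    unfolding has_density_def by blast
  ultimately have lim: "(\<lambda>n. ?ratio B (s n) * inverse (real n / real (s n))) \<longlonglongrightarrow> 0"
    using tendsto_mult by fastforce
  have bound: "?ratio ?P n \<le> ?ratio B (s n) * inverse (real n / real (s n))" if "n \<ge> 1" for n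
  proof -
    have "s ` {k \<in> ?P. k \<le> n} \<subseteq> {k \<in> B. k \<le> s n}"
      using strict_mono_on_less_eq[OF mono] that by auto
    moreover have "inj_on s {k \<in> ?P. k \<le> n}"
      by (rule inj_on_subset[OF strict_mono_on_imp_inj_on[OF mono]]) auto
    ultimately have "card {k \<in> ?P. k \<le> n} \<le> card {k \<in> B. k \<le> s n}"
      by (intro card_inj_on_le) auto
    moreover have "s n > 0"
      using strict_mono_on_from_1_ge[OF mono range that] that by simp
    ultimately show ?thesis
      using that by (simp add: divide_right_mono)
  qed
  have "(\<lambda>n. ?ratio ?P n) \<longlonglongrightarrow> 0"
  proof (rule tendsto_sandwich[OF _ _ tendsto_const lim])
    show "\<forall>\<^sub>F n in sequentially. 0 \<le> ?ratio ?P n"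
      by simp
    show "\<forall>\<^sub>F n in sequentially. ?ratio ?P n \<le> ?ratio B (s n) * inverse (real n / real (s n))"
      using eventually_ge_at_top[of 1] by (rule eventually_mono) (rule bound)
  qed
  then show ?thesis
    by (auto simp: has_density_def)
qed

lemma stat_r_converges_dense_subsequence:
  assumes conv: "stat_r_converges r l a" and sub: "stat_dense_subsequence h l"
  shows "stat_r_converges r h a"
proof -
  obtain s where mono: "strict_mono_on {1..} s" and range: "s ` {1..} \<subseteq> {1..}"
    and h: "\<And>k. k \<ge> 1 \<Longrightarrow> h k = l (s k)" and dens: "has_density (s ` {1..}) 1"
    using sub
    unfolding stat_dense_subsequence_def subsequence_via_def statistically_dense_def by blast
  have "has_density {i \<in> {1..}. \<bar>h i - a\<bar> \<ge> r + \<epsilon>} 0" if "\<epsilon> > 0" for \<epsilon>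
  proof -
    have "{i \<in> {1..}. \<bar>h i - a\<bar> \<ge> r + \<epsilon>} = {k \<in> {1..}. s k \<in> {i \<in> {1..}. \<bar>l i - a\<bar> \<ge> r + \<epsilon>}}"
      using range h by auto
    moreover have "has_density {i \<in> {1..}. \<bar>l i - a\<bar> \<ge> r + \<epsilon>} 0"
      using conv that by (simp add: stat_r_converges_def)
    ultimately show ?thesis
      using has_density_0_preimage[OF mono dens one_neq_zero] by presburger
  qed
  then show ?thesis
    by (simp add: stat_r_converges_def)
qed

lemma stat_dense_subsequence_refl: "stat_dense_subsequence l l"
proof -
  have "strict_mono_on {1..} (\<lambda>n::nat. n)"
    by (simp add: strict_mono_on_def)
  then have "card {k \<in> {1..}. k \<le> n} = n" if "n \<ge> 1" for n :: nat
    using card_enumerated_upto[of "\<lambda>n. n" n] that by simp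
  then have "(\<lambda>n. real (card {k \<in> {1..}. k \<le> n}) / real n) \<longlonglongrightarrow> 1"
    by (intro tendsto_eventually eventually_mono[OF eventually_ge_at_top[of 1]]) auto
  then have "subsequence_via (\<lambda>n. n) l l \<and> statistically_dense ((\<lambda>n. n) ` {1..})"
    by (simp add: subsequence_via_def strict_mono_on_def statistically_dense_def has_density_def)
  then show ?thesis
    unfolding stat_dense_subsequence_def by blast
qed

theorem theorem3p1:
  fixes r :: real and l :: "nat \<Rightarrow> real"
  assumes "r \<ge> 0"
  shows "stat_r_convergent r l \<longleftrightarrow>
    (\<forall>h. stat_dense_subsequence h l \<longrightarrow> stat_r_convergent r h)"
  using stat_r_converges_dense_subsequence stat_dense_subsequence_refl
  unfolding stat_r_convergent_def by blast

end
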